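(* Let $\mu,\alpha\in\mathbb{R}^d$, let $\Sigma\in\mathbb{R}^{d\times d}$ be symmetric positive definite, let $q(w)$ be a probability distribution of a scalar variable $w$ that does not depend on $(\mu,\alpha,\Sigma)$, and let $u,v$ be real-valued functions of $w$ with $v(w)>0$. Let $$q(w,z)=q(w,z\mid\mu,\alpha,\Sigma):=\mathcal{N}\big(z\mid \mu+u(w)\alpha,\;v(w)\Sigma\big)\,q(w),\qquad q(z)=q(z\mid\mu,\alpha,\Sigma):=\int q(w,z\mid\mu,\alpha,\Sigma)\,dw$$ be the Gaussian variance-mean mixture and its joint distribution. Let $h:\mathbb{R}^d\to\mathbb{R}$ be locally ACL and continuous. Assume that all expectations appearing here, namely $\mathbb{E}_{q(z)}[h(z)]$, $\mathbb{E}_{q(z)}[\nabla_z h(z)]$, $\mathbb{E}_{q(w,z)}[u(w)\nabla_z h(z)]$, and $\mathbb{E}_{q(w,z)}\big[h(z)\frac{\nabla_{\lambda}q(w,z)}{q(w,z)}\big]$ for $\lambda\in\{\mu,\alpha\}$, are well-defined, and that differentiation and integration may be interchanged, i.e. $\nabla_{\lambda}\mathbb{E}_{q(z)}[h(z)]=\mathbb{E}_{q(w,z)}\big[h(z)\frac{\nabla_{\lambda}q(w,z)}{q(w,z)}\big]$ for $\lambda\in\{\mu,\alpha\}$. Then $$\nabla_{\mu}\mathbb{E}_{q(z)}[h(z)]=\mathbb{E}_{q(z)}[\nabla_z h(z)],\qquad \nabla_{\alpha}\mathbb{E}_{q(z)}[h(z)]=\mathbb{E}_{q(w,z)}[u(w)\nabla_z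 h(z)].$$
   Context: $\mathcal{N}(z\mid m,S)$ is the density of the Gaussian distribution with mean $m$ and covariance $S$. An expectation $\mathbb{E}_q[g]$ is called well-defined if $\mathbb{E}_q[\|g\|]<\infty$ (Euclidean norm; Frobenius norm for matrices). A function $g:[a,b]\to\mathbb{R}^m$ is absolutely continuous (AC) if its derivative exists almost everywhere on $[a,b]$, is Lebesgue integrable, and $g(x)=g(a)+\int_a^x g'(t)\,dt$ for all $x\in[a,b]$. A function $g:\mathbb{R}\to\mathbb{R}^m$ is locally AC if it is AC on every compact interval. A function $h:\mathbb{R}^d\to\mathbb{R}^m$ is locally ACL if for every $i$ and almost every $z_{-i}\in\mathbb{R}^{d-1}$ (all coordinates except the $i$-th), the function $z_i\mapsto h(z_i,z_{-i})$ is locally AC. For such $h$ (with $m=1$), $\nabla_z h$ is the (column) vector of partial derivatives, which exists almost everywhere. *)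

theory Defs
  imports "HOL-Probability.Probability"
begin

definition symmetric_pos_def :: "real^'n^'n \<Rightarrow> bool" where
  "symmetric_pos_def S \<longleftrightarrow> transpose S = S \<and> (\<forall>x. x \<noteq> 0 \<longrightarrow> x \<bullet> (S *v x) > 0)"

definition gaussian_density :: "real^'n \<Rightarrow> real^'n^'n \<Rightarrow> real^'n \<Rightarrow> real" where
  "gaussian_density m S z =
     exp (- ((z - m) \<bullet> (matrix_inv S *v (z - m))) / 2) / sqrt ((2 * pi) ^ CARD('n) * det S)"


text \<open>Gradients are vectors of partial derivatives, with no total differentiability implied.
  The relation \<open>has_gradient\<close> includes the existence of all partial derivatives; a component of
  \<open>gradient\<close> is an unspecified real number wherever that partial derivative does not exist.\<close>

definition subst_coord :: "real^'n \<Rightarrow> 'n \<Rightarrow> real \<Rightarrow> real^'n" where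
  "subst_coord x i t = (\<chi> j. if j = i then t else x $ j)"

definition has_gradient :: "(real^'n \<Rightarrow> real) \<Rightarrow> real^'n \<Rightarrow> real^'n \<Rightarrow> bool" where
  "has_gradient f g x \<longleftrightarrow>
     (\<forall>i. ((\<lambda>t. f (subst_coord x i t)) has_real_derivative g $ i) (at (x $ i)))"

definition gradient :: "(real^'n \<Rightarrow> real) \<Rightarrow> real^'n \<Rightarrow> real^'n" where
  "gradient f x = (\<chi> i. deriv (\<lambda>t. f (subst_coord x i t)) (x $ i))"


definition abs_cont_on :: "real \<Rightarrow> real \<Rightarrow> (real \<Rightarrow> 'b::euclidean_space) \<Rightarrow> bool" where
  "abs_cont_on a b g \<longleftrightarrow>
     (AE t in lebesgue. t \<in> {a..b} \<longrightarrow> g differentiable (at t)) \<and>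
     (\<lambda>t. vector_derivative g (at t)) absolutely_integrable_on {a..b} \<and>
     (\<forall>x\<in>{a..b}. g x = g a + (LINT t:{a..x}|lebesgue. vector_derivative g (at t)))"

definition locally_abs_cont :: "(real \<Rightarrow> 'b::euclidean_space) \<Rightarrow> bool" where
  "locally_abs_cont g \<longleftrightarrow> (\<forall>a b. a \<le> b \<longrightarrow> abs_cont_on a b g)"

text \<open>The space of the remaining \<open>d - 1\<close> coordinates is the product of copies of the real line
  over all indices other than \<open>i\<close>.\<close>

definition locally_ACL :: "(real^'n \<Rightarrow> 'b::euclidean_space) \<Rightarrow> bool" where
  "locally_ACL h \<longleftrightarrow>
     (\<forall>i. AE y in (\<Pi>\<^sub>M j\<in>UNIV - {i}. (lborel :: real measure)).
        locally_abs_cont (\<lambda>t. h (\<chi> j. if j = i then t else y j)))"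


text \<open>The law of \<open>w\<close> has density \<open>p\<close> with respect to a reference measure \<open>B\<close> on scalars, playing
  the role of \<open>dw\<close>. Taking \<open>B = lborel\<close>, possibly restricted to the range of \<open>w\<close>, gives Lebesgue
  densities; counting measures give discrete laws; and an arbitrary probability law is
  its own reference measure with \<open>p = 1\<close>.\<close>

definition gvm_joint_density ::
  "(real \<Rightarrow> real) \<Rightarrow> (real \<Rightarrow> real) \<Rightarrow> (real \<Rightarrow> real) \<Rightarrow>
   real^'n \<Rightarrow> real^'n \<Rightarrow> real^'n^'n \<Rightarrow> real \<Rightarrow> real^'n \<Rightarrow> real" where
  "gvm_joint_density p u v \<mu> \<alpha> S w z =
     gaussian_density (\<mu> + u w *\<^sub>R \<alpha>) (v w *\<^sub>R S) z * p w"

definition gvm_joint ::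
  "real measure \<Rightarrow> (real \<Rightarrow> real) \<Rightarrow> (real \<Rightarrow> real) \<Rightarrow> (real \<Rightarrow> real) \<Rightarrow>
   real^'n \<Rightarrow> real^'n \<Rightarrow> real^'n^'n \<Rightarrow> (real \<times> (real^'n)) measure" where
  "gvm_joint B p u v \<mu> \<alpha> S =
     density (B \<Otimes>\<^sub>M lborel) (\<lambda>(w, z). ennreal (gvm_joint_density p u v \<mu> \<alpha> S w z))"

definition gvm_marginal ::
  "real measure \<Rightarrow> (real \<Rightarrow> real) \<Rightarrow> (real \<Rightarrow> real) \<Rightarrow> (real \<Rightarrow> real) \<Rightarrow>
   real^'n \<Rightarrow> real^'n \<Rightarrow> real^'n^'n \<Rightarrow> (real^'n) measure" where
  "gvm_marginal B p u v \<mu> \<alpha> S =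
     density lborel (\<lambda>z. \<integral>\<^sup>+ w. ennreal (gvm_joint_density p u v \<mu> \<alpha> S w z) \<partial>B)"

text \<open>The score functions \<open>\<nabla>q(w,z) / q(w,z)\<close> in \<open>\<mu>\<close> and in \<open>\<alpha>\<close>. They matter only where
  \<open>q(w,z) > 0\<close>, i.e. almost everywhere under the joint law.\<close>

definition score_mu ::
  "(real \<Rightarrow> real) \<Rightarrow> (real \<Rightarrow> real) \<Rightarrow> (real \<Rightarrow> real) \<Rightarrow>
   real^'n \<Rightarrow> real^'n \<Rightarrow> real^'n^'n \<Rightarrow> real \<Rightarrow> real^'n \<Rightarrow> real^'n" where
  "score_mu p u v \<mu> \<alpha> S w z =
     gradient (\<lambda>m. gvm_joint_density p u v m \<alpha> S w z) \<mu> /\<^sub>R gvm_joint_density p u v \<mu> \<alpha> S w z"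

definition score_alpha ::
  "(real \<Rightarrow> real) \<Rightarrow> (real \<Rightarrow> real) \<Rightarrow> (real \<Rightarrow> real) \<Rightarrow>
   real^'n \<Rightarrow> real^'n \<Rightarrow> real^'n^'n \<Rightarrow> real \<Rightarrow> real^'n \<Rightarrow> real^'n" where
  "score_alpha p u v \<mu> \<alpha> S w z =
     gradient (\<lambda>a. gvm_joint_density p u v \<mu> a S w z) \<alpha> /\<^sub>R gvm_joint_density p u v \<mu> \<alpha> S w z"

end

theory Submission
  imports Defs
begin

text \<open>Conditionally on \<open>w\<close> the law of \<open>z\<close> is Gaussian, and its density \<open>q(w, z)\<close> depends on \<open>\<mu>\<close> and
  \<open>z\<close> only through \<open>z - \<mu>\<close>, so \<open>\<nabla>\<^sub>\<mu> q = - \<nabla>\<^sub>z q\<close>, while \<open>\<nabla>\<^sub>\<alpha> q = u(w) \<nabla>\<^sub>\<mu> q\<close> by the chain rule. Hence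
  both identities follow, for almost every \<open>w\<close>, from integration by parts in each coordinate of \<open>z\<close>.
  Along almost every line parallel to a coordinate axis, \<open>f = h q\<close> is locally absolutely continuous
  and both \<open>f\<close> and \<open>f'\<close> are integrable; then \<open>f(x) - f(-x)\<close> is integrable on the real line and tends to
  \<open>\<integral> f'\<close>, which must therefore vanish.\<close>

section \<open>Integration by parts on the real line\<close>

text \<open>Fubini for \<open>D s * G' t\<close> on the triangle
  \<open>a \<le> s \<le> t \<le> b\<close>: integrating over \<open>s\<close> first gives
  \<open>(g t - g a) * G' t\<close>, integrating over \<open>t\<close> first gives
  \<open>D s * (G b - G s)\<close>. The function \<open>g\<close> enters only as a primitive of
  \<open>D\<close>.\<close>

lemma integral_by_parts_primitive:
  fixes g D G G' :: "real \<Rightarrow> real"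
  assumes "a \<le> b" and [measurable]: "D \<in> borel_measurable borel"
    and D: "set_integrable lborel {a..b} D"
    and g: "\<And>x. x \<in> {a..b} \<Longrightarrow> g x = g a + (LINT s:{a..x}|lborel. D s)"
    and G: "\<And>x. (G has_real_derivative G' x) (at x)"
    and G': "continuous_on UNIV G'"
  shows "(LINT x:{a..b}|lborel. D x * G x + g x * G' x) = g b * G b - g a * G a"
proof -
  have [measurable]: "G' \<in> borel_measurable borel"
    using G' by (rule borel_measurable_continuous_onI)
  have FTC: "(\<integral>t. indicator {s..b} t * G' t \<partial>lborel) = G b - G s" if "s \<le> b" for s
    using integral_FTC_atLeastAtMost[OF that, of G G']
      G continuous_on_subset[OF G']
    by (auto simp: has_real_derivative_iff_has_vector_derivative[symmetric]
        intro: has_field_derivative_at_within)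
  define K where "K = (\<lambda>t s. indicator {a..b} t * indicator {a..t} s * D s * G' t)"
  define Da where "Da = (\<lambda>s. indicator {a..b} s * D s)"
  define Ga where "Ga = (\<lambda>t. indicator {a..b} t * G' t)"
  have Da: "integrable lborel Da"
    using D by (simp add: set_integrable_def Da_def)
  have Ga: "integrable lborel Ga"
    using borel_integrable_compact[of "{a..b}" G'] continuous_on_subset[OF G']
    by (simp add: Ga_def set_integrable_def indicator_def if_distrib mult.commute cong: if_cong)
  have K: "integrable (lborel \<Otimes>\<^sub>M lborel) (\<lambda>(t, s). K t s)"
  proof (rule Bochner_Integration.integrable_bound)
    show "integrable (lborel \<Otimes>\<^sub>M lborel) (\<lambda>(t, s). Ga t * Da s)"
    proof (rule lborel_pair.Fubini_integrable)
      show "(\<lambda>(t, s). Ga t * Da s) \<in> borel_measurable (lborel \<Otimes>\<^sub>M lborel)"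
        unfolding Da_def Ga_def by measurable
      show "integrable lborel (\<lambda>x. \<integral>y. norm (case (x, y) of (t, s) \<Rightarrow> Ga t * Da s) \<partial>lborel)"
        using Ga by (simp add: abs_mult)
      show "AE x in lborel. integrable lborel (\<lambda>y. case (x, y) of (t, s) \<Rightarrow> Ga t * Da s)"
        using Da by simp
    qed
    \<comment> \<open>The factor \<open>indicator {a..t} s\<close> involves both variables; as a
      condition in an \<open>if\<close> it becomes a comparison of the two coordinates, which is
      jointly measurable.\<close>
    have "(\<lambda>(t, s). K t s) = (\<lambda>(t, s). if a \<le> t \<and> t \<le> b \<and> a \<le> s \<and> s \<le> t then D s * G' t else 0)"
      by (auto simp: K_def indicator_def fun_eq_iff)
    then show "(\<lambda>(t, s). K t s) \<in> borel_measurable (lborel \<Otimes>\<^sub>M lborel)"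
      by simp
    show "AE x in lborel \<Otimes>\<^sub>M lborel. norm (case x of (t, s) \<Rightarrow> K t s) \<le> norm (case x of (t, s) \<Rightarrow> Ga t * Da s)"
      by (auto simp: K_def Da_def Ga_def indicator_def abs_mult)
  qed
  have K1: "(\<integral>s. K t s \<partial>lborel) = indicator {a..b} t * (g t * G' t) - g a * Ga t" for t
  proof -
    have "K t s = (indicator {a..b} t * G' t) * (indicator {a..t} s * D s)" for s
      by (simp add: K_def mult_ac)
    then have "(\<integral>s. K t s \<partial>lborel) = (indicator {a..b} t * G' t) * (LINT s:{a..t}|lborel. D s)"
      by (simp add: set_lebesgue_integral_def)
    then show ?thesis
      using g[of t] by (auto simp: indicator_def Ga_def algebra_simps)
  qed
  have K2: "(\<integral>t. K t s \<partial>lborel) = G b * Da s - indicator {a..b} s * (D s * G s)" for s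
  proof -
    have "K t s = Da s * (indicator {s..b} t * G' t)" for t
      by (auto simp: K_def Da_def indicator_def)
    then have "(\<integral>t. K t s \<partial>lborel) = Da s * (\<integral>t. indicator {s..b} t * G' t \<partial>lborel)"
      by simp
    then show ?thesis
      using FTC[of s] by (cases "s \<in> {a..b}") (simp_all add: Da_def right_diff_distrib mult.commute)
  qed
  \<comment> \<open>Nothing is assumed about the measurability of \<open>g\<close>, so the
    integrability of \<open>g * G'\<close> is read off from the partial integrals of
    \<open>K\<close>; likewise for \<open>D * G\<close> below.\<close>
  have "integrable lborel (\<lambda>t. (indicator {a..b} t * (g t * G' t) - g a * Ga t) + g a * Ga t)"
    using lborel_pair.integrable_fst[OF K] Ga unfolding K1
    by (intro Bochner_Integration.integrable_add) auto
  then have I1: "integrable lborel (\<lambda>t. indicator {a..b} t * (g t * G' t))" by simp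
  have *: "integrable lborel (\<lambda>s. G b * Da s - indicator {a..b} s * (D s * G s))"
    using lborel_pair.integrable_snd[OF K] unfolding K2 .
  have "integrable lborel (\<lambda>s. G b * Da s - (G b * Da s - indicator {a..b} s * (D s * G s)))"
    by (rule Bochner_Integration.integrable_diff[OF integrable_mult_right[OF Da] *])
  then have I2: "integrable lborel (\<lambda>s. indicator {a..b} s * (D s * G s))" by simp
  have "(\<integral>t. (\<integral>s. K t s \<partial>lborel) \<partial>lborel) = (\<integral>s. (\<integral>t. K t s \<partial>lborel) \<partial>lborel)"
    using lborel_pair.Fubini_integral[OF K] by simp
  then have "(\<integral>t. indicator {a..b} t * (g t * G' t) \<partial>lborel) - g a * (\<integral>t. Ga t \<partial>lborel)
    = G b * (\<integral>s. Da s \<partial>lborel) - (\<integral>s. indicator {a..b} s * (D s * G s) \<partial>lborel)"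
    unfolding K1 K2 using I1 I2 Ga Da by simp
  moreover have "(\<integral>t. Ga t \<partial>lborel) = G b - G a"
    using FTC[OF \<open>a \<le> b\<close>] by (simp add: Ga_def)
  moreover have "(\<integral>s. Da s \<partial>lborel) = g b - g a"
    using g[of b] \<open>a \<le> b\<close> by (simp add: Da_def set_lebesgue_integral_def)
  ultimately show ?thesis
    using I1 I2 by (simp add: set_lebesgue_integral_def algebra_simps)
qed

text \<open>A nonzero limit keeps \<open>\<bar>f\<bar>\<close> above
  \<open>\<bar>I\<bar> / 2\<close> on a half-line, which has infinite measure.\<close>

lemma integrable_limit_at_top_zero:
  fixes f :: "real \<Rightarrow> real"
  assumes f: "integrable lborel f" and lim: "(f \<longlongrightarrow> I) at_top"
  shows "I = 0"
proof (rule ccontr)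
  assume "I \<noteq> 0"
  then have "\<forall>\<^sub>F x in at_top. dist (f x) I < \<bar>I\<bar> / 2"
    using lim by (intro tendstoD) auto
  then obtain N where N: "\<And>x. x \<ge> N \<Longrightarrow> dist (f x) I < \<bar>I\<bar> / 2"
    by (auto simp: eventually_at_top_linorder)
  have "integrable lborel (\<lambda>x. indicator {N..} x * (\<bar>I\<bar> / 2))"
  proof (rule Bochner_Integration.integrable_bound[OF f], measurable, rule AE_I2)
    show "norm (indicator {N..} x * (\<bar>I\<bar> / 2)) \<le> norm (f x)" for x
      using N[of x] by (auto simp: indicator_def dist_real_def abs_if split: if_splits)
  qed
  then have "integrable lborel (\<lambda>x. (2 / \<bar>I\<bar>) * (indicator {N..} x * (\<bar>I\<bar> / 2)))"
    by (rule integrable_mult_right)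
  then have "integrable lborel (indicat_real {N..})"
    using \<open>I \<noteq> 0\<close> by (simp add: mult.commute)
  then have "emeasure lborel {N..} < \<infinity>"
    by (simp add: integrable_indicator_iff)
  then obtain r where r: "0 \<le> r" "emeasure lborel {N..} = ennreal r"
    by (cases "emeasure lborel {N..}") auto
  \<comment> \<open>If the half-line had finite measure \<open>r\<close>, it would still contain an
    interval of length \<open>r + 1\<close>.\<close>
  have "emeasure lborel {N..N + (r + 1)} \<le> emeasure lborel {N..}"
    by (intro emeasure_mono) auto
  then show False
    using r by (simp del: ennreal_plus)
qed

text \<open>Integrability of \<open>g * G\<close> does not give pointwise decay at infinity.
  Truncating to \<open>{- y..y}\<close> turns the boundary terms into one integrable function of
  \<open>y\<close>; it has a limit by dominated convergence, and that limit can only be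
  zero.\<close>

lemma integral_by_parts_real_line:
  fixes g D G G' :: "real \<Rightarrow> real"
  assumes D_meas: "D \<in> borel_measurable borel"
    and D: "\<And>a b. a \<le> b \<Longrightarrow> set_integrable lborel {a..b} D"
    and g: "\<And>a b. a \<le> b \<Longrightarrow> g b = g a + (LINT s:{a..b}|lborel. D s)"
    and G: "\<And>x. (G has_real_derivative G' x) (at x)"
    and G': "continuous_on UNIV G'"
    and int: "integrable lborel (\<lambda>x. g x * G x)"
    and int': "integrable lborel (\<lambda>x. D x * G x + g x * G' x)"
  shows "(\<integral>x. D x * G x + g x * G' x \<partial>lborel) = 0"
proof -
  define F where "F = (\<lambda>x. D x * G x + g x * G' x)"
  define f where "f = (\<lambda>x. g x * G x)"
  have parts: "(\<integral>x. indicator {- y..y} x * F x \<partial>lborel) = f y - f (- y)" if "0 \<le> y" for y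
    using integral_by_parts_primitive[OF _ D_meas D g G G', of "- y" y] that
    by (simp add: F_def f_def set_lebesgue_integral_def)
  have "((\<lambda>y. \<integral>x. indicator {- y..y} x * F x \<partial>lborel) \<longlongrightarrow> (\<integral>x. F x \<partial>lborel)) at_top"
  proof (rule integral_dominated_convergence_at_top[where w = "\<lambda>x. norm (F x)"])
    show "AE x in lborel. ((\<lambda>y. indicator {- y..y} x * F x) \<longlongrightarrow> F x) at_top"
    proof (rule AE_I2, rule tendsto_eventually)
      show "\<forall>\<^sub>F y in at_top. indicator {- y..y} x * F x = F x" for x
        using eventually_ge_at_top[of "\<bar>x\<bar>"] by eventually_elim (auto simp: indicator_def)
    qed
  qed (use int' in \<open>auto simp: F_def indicator_def\<close>)
  moreover have "\<forall>\<^sub>F y in at_top. (\<integral>x. indicator {- y..y} x * F x \<partial>lborel) = f y - f (- y)"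
    using eventually_ge_at_top[of 0] by eventually_elim (rule parts)
  ultimately have "((\<lambda>y. f y - f (- y)) \<longlongrightarrow> (\<integral>x. F x \<partial>lborel)) at_top"
    by (rule Lim_transform_eventually)
  moreover have "integrable lborel (\<lambda>y. f y - f (- y))"
    using int lborel_integrable_real_affine[of f "-1" 0] by (auto simp: f_def)
  ultimately show ?thesis
    using integrable_limit_at_top_zero by (auto simp: F_def)
qed

section \<open>Slicing Lebesgue measure along one coordinate\<close>

lemma measurable_vec_slice:
  "(\<lambda>(y, t). (\<chi> j. if j = i then t else y j) :: real^'n)
    \<in> ((\<Pi>\<^sub>M j\<in>UNIV - {i}. lborel) \<Otimes>\<^sub>M lborel) \<rightarrow>\<^sub>M borel" (is "?T \<in> ?Y \<Otimes>\<^sub>M _ \<rightarrow>\<^sub>M _")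
proof (rule borel_measurable_euclidean_space[THEN iffD2], rule ballI)
  fix b :: "real^'n" assume "b \<in> Basis"
  then obtain j where "b = axis j 1"
    by (auto simp: Basis_vec_def)
  then show "(\<lambda>x. ?T x \<bullet> b) \<in> borel_measurable (?Y \<Otimes>\<^sub>M lborel)"
    by (cases "j = i") (simp_all add: inner_axis case_prod_unfold)
qed

text \<open>Lebesgue measure is determined by its values on boxes, and the preimage of a box is a
  box in the other coordinates times an interval. This connects the measure used in
  \<open>locally_ACL\<close> with \<open>lborel\<close> on vectors.\<close>

lemma lborel_vec_slice:
  "(lborel :: (real^'n) measure) =
    distr ((\<Pi>\<^sub>M j\<in>UNIV - {i}. lborel) \<Otimes>\<^sub>M lborel) borel (\<lambda>(y, t). \<chi> j. if j = i then t else y j)"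
    (is "_ = distr (?Y \<Otimes>\<^sub>M _) _ ?T")
proof (rule lborel_eqI)
  interpret P: product_sigma_finite "\<lambda>_::'n. lborel :: real measure"
    by standard
  interpret Y: sigma_finite_measure ?Y
    by (rule P.sigma_finite) simp
  note T[measurable] = measurable_vec_slice[of i]
  fix l u :: "real^'n" assume lu: "\<And>b. b \<in> Basis \<Longrightarrow> l \<bullet> b \<le> u \<bullet> b"
  have le: "l $ j \<le> u $ j" for j
    using lu[of "axis j 1"] by (simp add: inner_axis)
  have "?T -` box l u \<inter> space (?Y \<Otimes>\<^sub>M lborel) = PiE (UNIV - {i}) (\<lambda>j. {l $ j<..<u $ j}) \<times> {l $ i<..<u $ i}"
  proof (rule set_eqI, clarify)
    fix y t
    have "(\<forall>j. l $ j < (if j = i then t else y j) \<and> (if j = i then t else y j) < u $ j) \<longleftrightarrow>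
        (l $ i < t \<and> t < u $ i) \<and> (\<forall>j\<in>UNIV - {i}. l $ j < y j \<and> y j < u $ j)"
      by (rule iffI) (metis DiffE insertI1, simp)
    \<comment> \<open>Points of the product space are functions that are \<open>undefined\<close> at
      \<open>i\<close>, hence the conjunct on \<open>extensional\<close> on both sides.\<close>
    moreover have "(y, t) \<in> ?T -` box l u \<inter> space (?Y \<Otimes>\<^sub>M lborel) \<longleftrightarrow> y \<in> extensional (UNIV - {i}) \<and>
        (\<forall>j. l $ j < (if j = i then t else y j) \<and> (if j = i then t else y j) < u $ j)"
      by (simp only: vimage_def space_pair_measure space_PiM PiE_iff mem_box_cart Int_iff mem_Collect_eq
          case_prod_conv mem_Times_iff fst_conv snd_conv space_lborel space_borel UNIV_I simp_thms ball_simps vec_lambda_beta)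
        blast
    moreover have "(y, t) \<in> PiE (UNIV - {i}) (\<lambda>j. {l $ j<..<u $ j}) \<times> {l $ i<..<u $ i} \<longleftrightarrow>
        y \<in> extensional (UNIV - {i}) \<and> (l $ i < t \<and> t < u $ i) \<and> (\<forall>j\<in>UNIV - {i}. l $ j < y j \<and> y j < u $ j)"
      by (simp only: PiE_iff mem_Times_iff fst_conv snd_conv greaterThanLessThan_iff) blast
    ultimately show "(y, t) \<in> ?T -` box l u \<inter> space (?Y \<Otimes>\<^sub>M lborel) \<longleftrightarrow>
        (y, t) \<in> PiE (UNIV - {i}) (\<lambda>j. {l $ j<..<u $ j}) \<times> {l $ i<..<u $ i}"
      by blast
  qed
  then have "emeasure (distr (?Y \<Otimes>\<^sub>M lborel) borel ?T) (box l u) =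
      emeasure ?Y (PiE (UNIV - {i}) (\<lambda>j. {l $ j<..<u $ j})) * emeasure lborel {l $ i<..<u $ i}"
    by (simp add: emeasure_distr lborel.emeasure_pair_measure_Times sets_PiM_I_finite)
  also have "\<dots> = (\<Prod>j\<in>UNIV - {i}. ennreal (u $ j - l $ j)) * ennreal (u $ i - l $ i)"
    by (subst P.emeasure_PiM) (auto simp: le)
  also have "\<dots> = (\<Prod>j\<in>UNIV. ennreal (u $ j - l $ j))"
    by (simp add: prod.remove[of UNIV i] mult.commute)
  also have "\<dots> = ennreal (\<Prod>j\<in>UNIV. (u - l) $ j)"
    by (simp add: prod_ennreal le)
  also have "(\<Prod>j\<in>UNIV. (u - l) $ j) = (\<Prod>b\<in>Basis. (u - l) \<bullet> b)"
    by (simp add: Basis_vec_def UNION_singleton_eq_range inner_axis prod.reindex inj_on_def axis_eq_axis)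
  finally show "emeasure (distr (?Y \<Otimes>\<^sub>M lborel) borel ?T) (box l u) = (\<Prod>b\<in>Basis. (u - l) \<bullet> b)" .
qed simp

section \<open>Positive definite matrices and their inverses\<close>

text \<open>A nonzero kernel vector would make the quadratic form vanish, so the kernel is
  trivial.\<close>

lemma positive_definite_invertible:
  fixes S :: "real^'n^'n"
  assumes "\<And>x. x \<noteq> 0 \<Longrightarrow> x \<bullet> (S *v x) > 0"
  shows "invertible S"
proof -
  have "\<forall>x. S *v x = 0 \<longrightarrow> x = 0"
    using assms by (metis inner_zero_right less_irrefl)
  then have "\<exists>B. B ** S = mat 1" by (simp add: matrix_left_invertible_ker)
  then show ?thesis by (simp add: invertible_left_inverse)
qed

text \<open>The segment from the identity to \<open>S\<close> consists of positive definite, hence invertible,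
  matrices, so the determinant keeps its sign along it.\<close>

lemma det_pos_symmetric_pos_def:
  fixes S :: "real^'n^'n"
  assumes "symmetric_pos_def S"
  shows "det S > 0"
proof (rule ccontr)
  define A where "A t = (1 - t) *\<^sub>R mat 1 + t *\<^sub>R S" for t
  have "continuous_on {0..1} (\<lambda>t. det (A t))"
    unfolding A_def det_def by (intro continuous_intros)
  moreover assume "\<not> det S > 0"
  ultimately obtain t where t: "0 \<le> t" "t \<le> 1" "det (A t) = 0"
    using IVT2'[of "\<lambda>t. det (A t)" 1 0 0] by (auto simp: A_def)
  have "x \<bullet> (A t *v x) > 0" if "x \<noteq> 0" for x
  proof -
    have "x \<bullet> (A t *v x) = (1 - t) * (x \<bullet> x) + t * (x \<bullet> (S *v x))"
      by (simp add: A_def matrix_vector_mult_add_rdistrib scaleR_matrix_vector_assoc[symmetric] inner_add_right)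
    moreover have "x \<bullet> x > 0" "x \<bullet> (S *v x) > 0"
      using that assms by (auto simp: symmetric_pos_def_def)
    \<comment> \<open>The second summand is strictly positive unless \<open>t = 0\<close>, and then
      the first one is \<open>x \<bullet> x\<close>.\<close>
    ultimately show ?thesis
      using t by (cases "t = 0") (auto intro: add_nonneg_pos)
  qed
  then show False
    using positive_definite_invertible[of "A t"] t by (simp add: invertible_det_nz)
qed

text \<open>\<open>matrix_inv\<close> is a choice among two-sided inverses, so \<open>R\<close> must
  first be seen to be two-sided before anything is known about the chosen value.\<close>

lemma matrix_inv_unique:
  fixes S :: "real^'n^'n"
  assumes "S ** R = mat 1"
  shows "matrix_inv S = R"
proof -
  have "R ** S = mat 1"
    using assms by (simp add: matrix_left_right_inverse)
  then have "\<exists>A'. S ** A' = mat 1 \<and> A' ** S = mat 1"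
    using assms by blast
  then have "matrix_inv S ** S = mat 1"
    unfolding matrix_inv_def by (rule someI2_ex) simp
  then have "matrix_inv S = matrix_inv S ** (S ** R)"
    by (simp add: assms)
  also have "\<dots> = R"
    using \<open>matrix_inv S ** S = mat 1\<close> by (simp add: matrix_mul_assoc)
  finally show ?thesis .
qed

lemma transpose_matrix_inv_symmetric:
  fixes S :: "real^'n^'n"
  assumes "invertible S" "transpose S = S"
  shows "transpose (matrix_inv S) = matrix_inv S"
proof -
  obtain R where R: "S ** R = mat 1" "R ** S = mat 1"
    using assms(1) by (auto simp: invertible_def)
  have "S ** transpose R = mat 1"
    using R(2) assms(2) by (metis matrix_transpose_mul transpose_mat)
  then show ?thesis
    using matrix_inv_unique R(1) by metis
qed

lemma matrix_inv_scaleR: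
  fixes S :: "real^'n^'n"
  assumes "invertible S" "c \<noteq> 0"
  shows "matrix_inv (c *\<^sub>R S) = inverse c *\<^sub>R matrix_inv S"
proof -
  obtain R where R: "S ** R = mat 1"
    using assms(1) by (auto simp: invertible_def)
  have "(c *\<^sub>R S) ** (inverse c *\<^sub>R R) = mat 1"
    using R assms(2) by (simp add: matrix_scalar_ac scalar_matrix_assoc[symmetric])
  then show ?thesis
    using matrix_inv_unique R by metis
qed

lemma det_scaleR:
  fixes S :: "real^'n^'n"
  shows "det (c *\<^sub>R S) = c ^ CARD('n) * det S"
  by (simp add: det_def prod.distrib sum_distrib_left mult_ac)

section \<open>Integration by parts for locally ACL functions\<close>

text \<open>Moves absolute continuity from \<open>lebesgue\<close> and
  \<open>vector_derivative\<close> to \<open>lborel\<close> and \<open>deriv\<close>, as Fubini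
  requires. The two derivatives agree wherever \<open>g\<close> is differentiable, hence almost
  everywhere, and completion does not change integrals of Borel functions.\<close>

lemma locally_abs_cont_deriv:
  fixes g D :: "real \<Rightarrow> real"
  assumes g: "locally_abs_cont g" and [measurable]: "D \<in> borel_measurable borel"
    and D: "\<And>t. D t = deriv g t" and ab: "a \<le> b"
  shows "set_integrable lborel {a..b} D"
    and "g b = g a + (LINT t:{a..b}|lborel. D t)"
proof -
  define V where "V = (\<lambda>t. indicator {a..b} t *\<^sub>R vector_derivative g (at t))"
  define W where "W = (\<lambda>t. indicator {a..b} t *\<^sub>R D t)"
  have ac: "abs_cont_on a b g"
    using g ab by (simp add: locally_abs_cont_def)
  then have V: "integrable lebesgue V"
    by (simp add: abs_cont_on_def V_def set_integrable_def)
  have W[measurable]: "W \<in> borel_measurable lborel"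
    unfolding W_def by measurable
  then have W': "W \<in> borel_measurable lebesgue"
    by (rule measurable_completion)
  have "AE t in lebesgue. t \<in> {a..b} \<longrightarrow> g differentiable (at t)"
    using ac by (simp add: abs_cont_on_def)
  then have VW: "AE t in lebesgue. V t = W t"
  proof eventually_elim
    case (elim t)
    have "vector_derivative g (at t) = deriv g t" if "g differentiable (at t)"
      using that
      by (metis DERIV_imp_deriv has_real_derivative_iff_has_vector_derivative real_differentiableE
          vector_derivative_at)
    then show ?case
      using elim by (simp add: V_def W_def D indicator_def)
  qed
  have "integrable lebesgue W"
    using V VW W' integrable_cong_AE[of V lebesgue W] by (simp add: borel_measurable_integrable)
  then show "set_integrable lborel {a..b} D"
    using integrable_completion[OF W] by (simp add: W_def set_integrable_def)
  have "\<forall>x\<in>{a..b}. g x = g a + (LINT t:{a..x}|lebesgue. vector_derivative g (at t))"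
    using ac unfolding abs_cont_on_def by (elim conjE)
  from bspec[OF this, of b] ab have "g b = g a + integral\<^sup>L lebesgue V"
    unfolding V_def set_lebesgue_integral_def by simp
  also have "integral\<^sup>L lebesgue V = integral\<^sup>L lebesgue W"
    using V VW W' by (intro integral_cong_AE) auto
  also have "\<dots> = integral\<^sup>L lborel W"
    by (rule integral_completion[OF W])
  finally show "g b = g a + (LINT t:{a..b}|lborel. D t)"
    by (simp add: W_def set_lebesgue_integral_def)
qed

text \<open>\<open>F\<close> is the partial derivative of \<open>h * G\<close> along coordinate
  \<open>i\<close>. Its integral over almost every line in that direction is zero, so by Fubini its
  integral over the whole space is zero.\<close>

lemma integral_partial_by_parts_ACL:
  fixes h G G' :: "real^'n \<Rightarrow> real"
  assumes h: "locally_ACL h" "continuous_on UNIV h"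
    and D: "(\<lambda>z. gradient h z $ i) \<in> borel_measurable borel"
    and G: "\<And>x. ((\<lambda>t. G (subst_coord x i t)) has_real_derivative G' x) (at (x $ i))"
    and cont: "continuous_on UNIV G'"
    and int: "integrable lborel (\<lambda>z. h z * G z)"
    and int1: "integrable lborel (\<lambda>z. gradient h z $ i * G z)"
    and int2: "integrable lborel (\<lambda>z. h z * G' z)"
  shows "(\<integral>z. gradient h z $ i * G z \<partial>lborel) = - (\<integral>z. h z * G' z \<partial>lborel)"
proof -
  define Y where "Y = (\<Pi>\<^sub>M j\<in>UNIV - {i}. lborel :: real measure)"
  define T where "T = (\<lambda>y t. (\<chi> j. if j = i then t else y j) :: real^'n)"
  define F where "F = (\<lambda>z. gradient h z $ i * G z + h z * G' z)"
  interpret P: product_sigma_finite "\<lambda>_::'n. lborel :: real measure"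
    by standard
  interpret Y: sigma_finite_measure Y
    unfolding Y_def by (rule P.sigma_finite) simp
  interpret YL: pair_sigma_finite Y "lborel :: real measure" ..
  have lborel: "lborel = distr (Y \<Otimes>\<^sub>M lborel) borel (\<lambda>(y, t). T y t)"
    unfolding Y_def T_def by (rule lborel_vec_slice)
  have T[measurable]: "(\<lambda>(y, t). T y t) \<in> (Y \<Otimes>\<^sub>M lborel) \<rightarrow>\<^sub>M borel"
    unfolding T_def Y_def by (rule measurable_vec_slice)
  have T1: "continuous_on UNIV (T y)" for y
    unfolding T_def
  proof (rule continuous_on_vec_lambda)
    show "continuous_on UNIV (\<lambda>t. if j = i then t else y j)" for j
      by (cases "j = i") auto
  qed
  have slice: "integrable (Y \<Otimes>\<^sub>M lborel) (\<lambda>(y, t). f (T y t))"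
    if "integrable lborel f" for f :: "real^'n \<Rightarrow> real"
    using that T integrable_distr[OF T, of f] lborel by (simp add: case_prod_unfold)
  have F: "integrable lborel F"
    unfolding F_def by (rule Bochner_Integration.integrable_add[OF int1 int2])
  \<comment> \<open>Three null sets of lines are discarded: those where \<open>h * G\<close> is not
    integrable, those where \<open>F\<close> is not integrable, and those where \<open>h\<close> is
    not locally absolutely continuous.\<close>
  have zero: "AE y in Y. (\<integral>t. F (T y t) \<partial>lborel) = 0"
    using YL.AE_integrable_fst[OF slice[OF int]] YL.AE_integrable_fst[OF slice[OF F]]
      h(1)[unfolded locally_ACL_def, rule_format, of i, folded Y_def]
  proof eventually_elim
    case (elim y)
    \<comment> \<open>Substituting coordinate \<open>i\<close> stays on the same line, so the
      partial derivative at \<open>T y t\<close> is the ordinary derivative of the slice at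
      \<open>t\<close>.\<close>
    have [simp]: "subst_coord (T y t) i s = T y s" "T y t $ i = t" for s t
      by (simp_all add: T_def subst_coord_def vec_eq_iff)
    have Dm: "(\<lambda>t. gradient h (T y t) $ i) \<in> borel_measurable borel"
      using D T1 by (intro measurable_compose[OF _ D] borel_measurable_continuous_onI)
    have deriv: "gradient h (T y t) $ i = deriv (\<lambda>t. h (T y t)) t" for t
      by (simp add: gradient_def)
    have "locally_abs_cont (\<lambda>t. h (T y t))"
      using elim(3) by (simp add: T_def)
    note ac = locally_abs_cont_deriv[OF this Dm deriv]
    show ?case
      unfolding F_def
    proof (rule integral_by_parts_real_line[OF Dm ac])
      show "((\<lambda>t. G (T y t)) has_real_derivative G' (T y t)) (at t)" for t
        using G[of "T y t"] by simp
      show "continuous_on UNIV (\<lambda>t. G' (T y t))"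
        using continuous_on_compose2[OF cont T1] by simp
    qed (use elim in \<open>auto simp: F_def\<close>)
  qed
  have "integral\<^sup>L lborel F = (\<integral>(y, t). F (T y t) \<partial>(Y \<Otimes>\<^sub>M lborel))"
    using integral_distr[OF T, of F] F lborel by (simp add: case_prod_unfold)
  also have "\<dots> = (\<integral>y. (\<integral>t. F (T y t) \<partial>lborel) \<partial>Y)"
    by (rule YL.integral_fst[OF slice[OF F], symmetric])
  also have "\<dots> = 0"
    using integral_eq_zero_AE[OF zero] .
  finally show ?thesis
    using int1 int2 by (simp add: F_def)
qed

section \<open>Derivatives of the Gaussian density\<close>

lemma inner_matrix_vector_symmetric:
  fixes P :: "real^'n^'n"
  assumes "transpose P = P"
  shows "x \<bullet> (P *v y) = y \<bullet> (P *v x)"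
  by (metis assms dot_lmul_matrix inner_commute transpose_matrix_vector)

text \<open>Along a coordinate direction the exponent is a quadratic polynomial in the displacement
  of the mean. The displacement \<open>k\<close> is left general so that one computation serves the
  partial derivatives in \<open>z\<close>, \<mu> and \<alpha>.\<close>

lemma gaussian_density_mean_line:
  fixes S :: "real^'n^'n"
  assumes P: "transpose (matrix_inv S) = matrix_inv S"
    and k[derivative_intros]: "(k has_real_derivative k') (at t)"
  shows "((\<lambda>s. gaussian_density (m + k s *\<^sub>R axis i 1) S z) has_real_derivative
    k' * (matrix_inv S *v (z - (m + k t *\<^sub>R axis i 1))) $ i * gaussian_density (m + k t *\<^sub>R axis i 1) S z) (at t)"
proof -
  define d where "d = z - m"
  define e :: "real^'n" where "e = axis i 1"
  let ?P = "matrix_inv S"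
  have e: "e \<bullet> x = x $ i" for x
    by (simp add: e_def inner_axis')
  \<comment> \<open>The symmetry of the inverse merges the two cross terms into one with factor
    2.\<close>
  have quad: "(z - (m + r *\<^sub>R e)) \<bullet> (?P *v (z - (m + r *\<^sub>R e))) =
      d \<bullet> (?P *v d) - 2 * r * (?P *v d) $ i + r\<^sup>2 * (?P *v e) $ i" for r
  proof -
    have "z - (m + r *\<^sub>R e) = d - r *\<^sub>R e" by (simp add: d_def)
    then show ?thesis
      using inner_matrix_vector_symmetric[OF P, of d e]
      by (simp add: matrix_vector_mult_diff_distrib matrix_vector_mult_scaleR inner_diff_left
          inner_diff_right e power2_eq_square algebra_simps)
  qed
  have nth: "(?P *v (z - (m + r *\<^sub>R e))) $ i = (?P *v d) $ i - r * (?P *v e) $ i" for r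
    by (simp add: d_def matrix_vector_mult_diff_distrib matrix_vector_mult_scaleR
        matrix_vector_mult_add_rdistrib matrix_vector_right_distrib algebra_simps)
  let ?Q = "\<lambda>s. d \<bullet> (?P *v d) - 2 * k s * (?P *v d) $ i + (k s)\<^sup>2 * (?P *v e) $ i"
  have "((\<lambda>s. exp (- ?Q s / 2)) has_real_derivative
      k' * ((?P *v d) $ i - k t * (?P *v e) $ i) * exp (- ?Q t / 2)) (at t)"
    by (auto intro!: derivative_eq_intros simp: power2_eq_square field_simps)
  from DERIV_cdivide[OF this, of "sqrt ((2 * pi) ^ CARD('n) * det S)"] show ?thesis
    unfolding gaussian_density_def e_def[symmetric] quad nth by simp
qed

lemma subst_coord_eq: "subst_coord x i t = x + (t - x $ i) *\<^sub>R axis i 1"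
  by (simp add: subst_coord_def vec_eq_iff axis_def)

text \<open>Only \<open>z - m\<close> matters, so moving coordinate \<open>i\<close> of
  \<open>z\<close> to \<open>t\<close> has the same effect as shifting the mean by
  \<open>z $ i - t\<close>, whose derivative is -1.\<close>

lemma gaussian_density_partial:
  fixes S :: "real^'n^'n"
  assumes P: "transpose (matrix_inv S) = matrix_inv S"
  shows "((\<lambda>t. gaussian_density m S (subst_coord z i t)) has_real_derivative
    - (matrix_inv S *v (z - m)) $ i * gaussian_density m S z) (at (z $ i))"
proof -
  have "gaussian_density m S (subst_coord z i t) = gaussian_density (m + (z $ i - t) *\<^sub>R axis i 1) S z" for t
    by (simp add: gaussian_density_def subst_coord_eq algebra_simps)
  moreover have "((\<lambda>t. z $ i - t) has_real_derivative -1) (at (z $ i))"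
    by (auto intro!: derivative_eq_intros)
  ultimately show ?thesis
    using gaussian_density_mean_line[OF P, of "\<lambda>t. z $ i - t" "-1" "z $ i" m i z] by simp
qed

lemma continuous_on_gaussian_density: "continuous_on UNIV (gaussian_density m S)"
  unfolding gaussian_density_def divide_inverse
  by (intro continuous_intros matrix_vector_mult_linear_continuous_on
      continuous_on_compose2[OF matrix_vector_mult_linear_continuous_on[of UNIV]]) auto

section \<open>Joint law, marginal law and scores of the mixture\<close>

context
  fixes \<mu> \<alpha> :: "real^'n" and \<Sigma> :: "real^'n^'n"
    and B :: "real measure" and p u v :: "real \<Rightarrow> real"
  assumes spd: "symmetric_pos_def \<Sigma>"
    and B: "sigma_finite_measure B"
    and p[measurable]: "p \<in> borel_measurable B" and p_nonneg: "\<And>w. w \<in> space B \<Longrightarrow> 0 \<le> p w"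
    and u[measurable]: "u \<in> borel_measurable B" and v[measurable]: "v \<in> borel_measurable B"
    and v_pos: "\<And>w. w \<in> space B \<Longrightarrow> 0 < v w"
begin

interpretation B: sigma_finite_measure B by (rule B)
interpretation BL: pair_sigma_finite B "lborel :: (real^'n) measure" ..

private abbreviation (input) "q \<equiv> gvm_joint_density p u v \<mu> \<alpha> \<Sigma>"
private abbreviation (input) "J \<equiv> gvm_joint B p u v \<mu> \<alpha> \<Sigma>"
private abbreviation (input) "precision w \<equiv> matrix_inv (v w *\<^sub>R \<Sigma>)"
private abbreviation (input) "mean w \<equiv> \<mu> + u w *\<^sub>R \<alpha>"

lemma invertible_covariance: "invertible \<Sigma>"
  using spd by (intro positive_definite_invertible) (auto simp: symmetric_pos_def_def)

lemma precision_eq: "w \<in> space B \<Longrightarrow> precision w = inverse (v w) *\<^sub>R matrix_inv \<Sigma>"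
  using v_pos[of w] by (intro matrix_inv_scaleR invertible_covariance) auto

lemma transpose_precision: "w \<in> space B \<Longrightarrow> transpose (precision w) = precision w"
  using transpose_matrix_inv_symmetric[OF invertible_covariance] spd
  by (simp add: precision_eq symmetric_pos_def_def transpose_scalar)

lemma joint_density_nonneg: "w \<in> space B \<Longrightarrow> 0 \<le> q w z"
  using det_pos_symmetric_pos_def[OF spd] p_nonneg[of w] v_pos[of w]
  by (simp add: gvm_joint_density_def gaussian_density_def det_scaleR)

lemma measurable_joint_density[measurable]:
  "(\<lambda>(w, z). q w z) \<in> borel_measurable (B \<Otimes>\<^sub>M lborel)"
proof -
  have [measurable]: "(\<lambda>x. matrix_inv \<Sigma> *v x) \<in> borel_measurable borel"
    by (intro borel_measurable_continuous_onI matrix_vector_mult_linear_continuous_on)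
  \<comment> \<open>On \<open>space B\<close> the scalar \<open>v w\<close> comes out of both the
    inverse and the determinant, leaving a fixed linear map and a constant that are visibly
    measurable.\<close>
  have "(\<lambda>(w, z). exp (- ((z - mean w) \<bullet> (inverse (v w) *\<^sub>R (matrix_inv \<Sigma> *v (z - mean w)))) / 2) /
      sqrt ((2 * pi) ^ CARD('n) * (v w ^ CARD('n) * det \<Sigma>)) * p w) \<in> borel_measurable (B \<Otimes>\<^sub>M lborel)"
    by measurable
  also have "?this \<longleftrightarrow> ?thesis"
    by (intro measurable_cong)
      (auto simp: space_pair_measure gvm_joint_density_def gaussian_density_def det_scaleR precision_eq
        scaleR_matrix_vector_assoc)
  finally show ?thesis .
qed

text \<open>Tonelli with the \<open>w\<close>-integral inside. It lets expectations under
  \<open>q(z)\<close> be computed under \<open>q(w, z)\<close>.\<close>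

lemma distr_joint_snd: "distr J lborel snd = gvm_marginal B p u v \<mu> \<alpha> \<Sigma>"
proof (rule measure_eqI)
  fix A assume "A \<in> sets (distr J lborel snd)"
  then have A[measurable]: "A \<in> sets borel" by simp
  have S: "snd -` A \<inter> space (B \<Otimes>\<^sub>M lborel) \<in> sets (B \<Otimes>\<^sub>M (lborel :: (real^'n) measure))"
    using measurable_sets[OF measurable_snd, of A lborel B] by simp
  have "emeasure (distr J lborel snd) A = emeasure J (snd -` A \<inter> space (B \<Otimes>\<^sub>M lborel))"
    using S by (subst emeasure_distr) (auto simp: gvm_joint_def)
  also have "\<dots> = (\<integral>\<^sup>+x. ennreal (case x of (w, z) \<Rightarrow> q w z) * indicator A (snd x) \<partial>(B \<Otimes>\<^sub>M lborel))"
    unfolding gvm_joint_def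
    using S by (subst emeasure_density) (auto simp: case_prod_unfold indicator_def intro!: nn_integral_cong)
  also have "\<dots> = (\<integral>\<^sup>+z. (\<integral>\<^sup>+w. ennreal (q w z) * indicator A z \<partial>B) \<partial>lborel)"
    by (subst BL.nn_integral_snd[symmetric]) simp_all
  also have "\<dots> = (\<integral>\<^sup>+z. (\<integral>\<^sup>+w. ennreal (q w z) \<partial>B) * indicator A z \<partial>lborel)"
    by (intro nn_integral_cong nn_integral_multc) simp
  also have "\<dots> = emeasure (gvm_marginal B p u v \<mu> \<alpha> \<Sigma>) A"
    unfolding gvm_marginal_def
    by (subst emeasure_density) auto
  finally show "emeasure (distr J lborel snd) A = emeasure (gvm_marginal B p u v \<mu> \<alpha> \<Sigma>) A" .
qed (simp add: gvm_marginal_def)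

lemma
  fixes f :: "real^'n \<Rightarrow> 'b::euclidean_space"
  assumes "integrable (gvm_marginal B p u v \<mu> \<alpha> \<Sigma>) f"
  shows integrable_marginal_joint: "integrable J (\<lambda>(w, z). f z)"
    and integral_marginal_joint: "(\<integral>z. f z \<partial>gvm_marginal B p u v \<mu> \<alpha> \<Sigma>) = (\<integral>(w, z). f z \<partial>J)"
proof -
  have snd: "snd \<in> measurable J lborel"
    by (simp add: gvm_joint_def)
  have f: "f \<in> borel_measurable lborel"
    using borel_measurable_integrable[OF assms] by (simp add: gvm_marginal_def)
  show "integrable J (\<lambda>(w, z). f z)"
    using assms integrable_distr_eq[OF snd f] by (simp add: distr_joint_snd case_prod_unfold)
  show "(\<integral>z. f z \<partial>gvm_marginal B p u v \<mu> \<alpha> \<Sigma>) = (\<integral>(w, z). f z \<partial>J)"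
    using integral_distr[OF snd f] by (simp add: distr_joint_snd case_prod_unfold)
qed

text \<open>Since \<open>q\<close> is nonnegative on \<open>space B\<close>, the density turns into
  a real factor in the integrand, and Fubini applies to \<open>q w z * f w z\<close>.\<close>

lemma
  fixes f :: "real \<Rightarrow> real^'n \<Rightarrow> real"
  assumes "integrable J (\<lambda>(w, z). f w z)"
  shows AE_integrable_joint_slice: "AE w in B. integrable lborel (\<lambda>z. q w z * f w z)"
    and measurable_joint_slice: "(\<lambda>w. \<integral>z. q w z * f w z \<partial>lborel) \<in> borel_measurable B"
    and integral_joint_iterated: "(\<integral>(w, z). f w z \<partial>J) = (\<integral>w. (\<integral>z. q w z * f w z \<partial>lborel) \<partial>B)"
proof -
  have f: "(\<lambda>(w, z). f w z) \<in> borel_measurable (B \<Otimes>\<^sub>M lborel)"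
    using borel_measurable_integrable[OF assms] by (simp add: gvm_joint_def)
  have J: "J = density (B \<Otimes>\<^sub>M lborel) (\<lambda>x. ennreal (case x of (w, z) \<Rightarrow> q w z))"
    by (simp add: gvm_joint_def case_prod_unfold)
  have nonneg: "AE x in B \<Otimes>\<^sub>M lborel. 0 \<le> (case x of (w, z) \<Rightarrow> q w z)"
    by (rule AE_I2) (auto simp: space_pair_measure joint_density_nonneg)
  have int: "integrable (B \<Otimes>\<^sub>M lborel) (\<lambda>(w, z). q w z * f w z)"
    using assms unfolding J integrable_density[OF f measurable_joint_density nonneg]
    by (simp add: case_prod_unfold)
  show "AE w in B. integrable lborel (\<lambda>z. q w z * f w z)"
    by (rule BL.AE_integrable_fst[OF int])
  show "(\<lambda>w. \<integral>z. q w z * f w z \<partial>lborel) \<in> borel_measurable B"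
    using BL.integrable_fst[OF int] by (rule borel_measurable_integrable)
  show "(\<integral>(w, z). f w z \<partial>J) = (\<integral>w. (\<integral>z. q w z * f w z \<partial>lborel) \<partial>B)"
    unfolding J integral_density[OF f measurable_joint_density nonneg] BL.integral_fst[OF int]
    by (simp add: case_prod_unfold)
qed

lemma
  fixes f :: "real \<Rightarrow> real^'n \<Rightarrow> real^'n"
  assumes "integrable J (\<lambda>(w, z). f w z)"
  shows integrable_joint_nth: "integrable J (\<lambda>(w, z). f w z $ i)"
    and integral_joint_nth: "(\<integral>(w, z). f w z \<partial>J) $ i = (\<integral>(w, z). f w z $ i \<partial>J)"
  using integrable_bounded_linear[OF bounded_linear_vec_nth assms, of i]
    integral_bounded_linear[OF bounded_linear_vec_nth assms, of i]
  by (simp_all add: case_prod_unfold)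

text \<open>Reduces an identity between vector expectations to the inner integrals, one coordinate
  at a time and for almost every \<open>w\<close>, which is how integration by parts delivers
  it.\<close>

lemma integral_joint_cong_AE:
  fixes f g :: "real \<Rightarrow> real^'n \<Rightarrow> real^'n"
  assumes f: "integrable J (\<lambda>(w, z). f w z)" and g: "integrable J (\<lambda>(w, z). g w z)"
    and "\<And>i. AE w in B. (\<integral>z. q w z * f w z $ i \<partial>lborel) = (\<integral>z. q w z * g w z $ i \<partial>lborel)"
  shows "(\<integral>(w, z). f w z \<partial>J) = (\<integral>(w, z). g w z \<partial>J)"
proof (rule vec_eq_iff[THEN iffD2], rule allI)
  fix i
  show "(\<integral>(w, z). f w z \<partial>J) $ i = (\<integral>(w, z). g w z \<partial>J) $ i"
    unfolding integral_joint_nth[OF f] integral_joint_nth[OF g]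
      integral_joint_iterated[OF integrable_joint_nth[OF f]]
      integral_joint_iterated[OF integrable_joint_nth[OF g]]
    by (intro integral_cong_AE measurable_joint_slice integrable_joint_nth f g assms(3))
qed

lemma joint_density_mean_line:
  assumes "w \<in> space B" and k: "(k has_real_derivative k') (at t)" and "k t = 0"
  shows "((\<lambda>s. gaussian_density (mean w + k s *\<^sub>R axis i 1) (v w *\<^sub>R \<Sigma>) z * p w) has_real_derivative
    k' * (precision w *v (z - mean w)) $ i * q w z) (at t)"
  using DERIV_cmult_right[OF gaussian_density_mean_line[OF transpose_precision[OF assms(1)] k, of "mean w" i z], of "p w"]
  by (simp add: gvm_joint_density_def assms(3) mult_ac)

text \<open>The score is multiplied by the density rather than isolated, so that the identity also
  covers \<open>p w = 0\<close>, where both sides vanish.\<close>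

lemma joint_density_score_mu:
  assumes "w \<in> space B"
  shows "q w z * score_mu p u v \<mu> \<alpha> \<Sigma> w z $ i = (precision w *v (z - mean w)) $ i * q w z"
proof -
  have "gvm_joint_density p u v (subst_coord \<mu> i t) \<alpha> \<Sigma> w z =
      gaussian_density (mean w + (t - \<mu> $ i) *\<^sub>R axis i 1) (v w *\<^sub>R \<Sigma>) z * p w" for t
    by (simp add: gvm_joint_density_def subst_coord_eq add_ac)
  moreover have "((\<lambda>t. t - \<mu> $ i) has_real_derivative 1) (at (\<mu> $ i))"
    by (auto intro!: derivative_eq_intros)
  ultimately have "((\<lambda>t. gvm_joint_density p u v (subst_coord \<mu> i t) \<alpha> \<Sigma> w z) has_real_derivative
      (precision w *v (z - mean w)) $ i * q w z) (at (\<mu> $ i))"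
    using joint_density_mean_line[OF assms, of "\<lambda>t. t - \<mu> $ i" 1 "\<mu> $ i" i z] by simp
  then show ?thesis
    using DERIV_imp_deriv by (fastforce simp: score_mu_def gradient_def)
qed

text \<open>Changing \<alpha> by some amount shifts the mean by \<open>u w\<close> times that
  amount, which is the chain-rule factor.\<close>

lemma joint_density_score_alpha:
  assumes "w \<in> space B"
  shows "q w z * score_alpha p u v \<mu> \<alpha> \<Sigma> w z $ i = u w * ((precision w *v (z - mean w)) $ i * q w z)"
proof -
  have "gvm_joint_density p u v \<mu> (subst_coord \<alpha> i t) \<Sigma> w z =
      gaussian_density (mean w + (u w * (t - \<alpha> $ i)) *\<^sub>R axis i 1) (v w *\<^sub>R \<Sigma>) z * p w" for t
    by (simp add: gvm_joint_density_def subst_coord_eq scaleR_add_right add.assoc)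
  moreover have "((\<lambda>t. u w * (t - \<alpha> $ i)) has_real_derivative u w) (at (\<alpha> $ i))"
    by (auto intro!: derivative_eq_intros)
  ultimately have "((\<lambda>t. gvm_joint_density p u v \<mu> (subst_coord \<alpha> i t) \<Sigma> w z) has_real_derivative
      u w * ((precision w *v (z - mean w)) $ i * q w z)) (at (\<alpha> $ i))"
    using joint_density_mean_line[OF assms, of "\<lambda>t. u w * (t - \<alpha> $ i)" "u w" "\<alpha> $ i" i z]
    by (simp add: mult.assoc)
  then show ?thesis
    using DERIV_imp_deriv by (fastforce simp: score_alpha_def gradient_def)
qed

text \<open>Stein's identity for the Gaussian law of \<open>z\<close> given \<open>w\<close>:
  integration by parts with \<open>G = q w\<close>.\<close>

lemma AE_conditional_stein:
  fixes h :: "real^'n \<Rightarrow> real"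
  assumes h: "locally_ACL h" "continuous_on UNIV h"
    and int: "integrable (gvm_marginal B p u v \<mu> \<alpha> \<Sigma>) h"
    and int1: "integrable (gvm_marginal B p u v \<mu> \<alpha> \<Sigma>) (gradient h)"
    and int2: "integrable J (\<lambda>(w, z). h z *\<^sub>R score_mu p u v \<mu> \<alpha> \<Sigma> w z)"
  shows "AE w in B. (\<integral>z. q w z * gradient h z $ i \<partial>lborel) =
    (\<integral>z. h z * ((precision w *v (z - mean w)) $ i * q w z) \<partial>lborel)"
  \<comment> \<open>These supply, for almost every \<open>w\<close>, the three integrability
    conditions of the integration by parts: for \<open>h\<close> times \<open>q\<close>, for the
    partial derivative of \<open>h\<close> times \<open>q\<close>, and for \<open>h\<close> times
    the partial derivative of \<open>q\<close>.\<close>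
  using AE_integrable_joint_slice[OF integrable_marginal_joint[OF int]]
    AE_integrable_joint_slice[OF integrable_joint_nth[OF integrable_marginal_joint[OF int1]], of i]
    AE_integrable_joint_slice[OF integrable_joint_nth[OF int2], of i] AE_space
proof eventually_elim
  case (elim w)
  \<comment> \<open>This is the partial derivative of \<open>q w\<close> in \<open>z $ i\<close> and
    also minus the one in \<open>\<mu> $ i\<close>, so integrability of \<open>h * ?G'\<close>
    follows from that of \<open>h\<close> times the \<mu>-score.\<close>
  let ?G' = "\<lambda>z. - (precision w *v (z - mean w)) $ i * q w z"
  \<comment> \<open>\<open>gradient h\<close> is unspecified where a partial derivative fails to
    exist; its measurability is part of the assumed integrability.\<close>
  have "gradient h \<in> borel_measurable lborel"
    using borel_measurable_integrable[OF int1] by (simp add: gvm_marginal_def)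
  from borel_measurable_inner[OF this borel_measurable_const[of "axis i 1"]]
  have D: "(\<lambda>z. gradient h z $ i) \<in> borel_measurable borel"
    by (simp add: inner_axis)
  have "q w z * (h z *\<^sub>R score_mu p u v \<mu> \<alpha> \<Sigma> w z) $ i = - (h z * ?G' z)" for z
    using joint_density_score_mu[OF elim(4), of z i] by (simp add: mult.left_commute)
  then have "integrable lborel (\<lambda>z. - (h z * ?G' z))"
    using elim(3) by (simp only:)
  from Bochner_Integration.integrable_minus[OF this] have "integrable lborel (\<lambda>z. h z * ?G' z)"
    by (simp only: minus_minus)
  moreover have "((\<lambda>t. q w (subst_coord z i t)) has_real_derivative ?G' z) (at (z $ i))" for z
    using DERIV_cmult_right[OF gaussian_density_partial[OF transpose_precision[OF elim(4)], of "mean w" z i], of "p w"]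
    by (simp add: gvm_joint_density_def mult_ac)
  moreover have "continuous_on UNIV ?G'"
    unfolding gvm_joint_density_def
    by (intro continuous_intros continuous_on_gaussian_density
        continuous_on_compose2[OF matrix_vector_mult_linear_continuous_on[of UNIV]]) auto
  ultimately have "(\<integral>z. gradient h z $ i * q w z \<partial>lborel) = - (\<integral>z. h z * ?G' z \<partial>lborel)"
    using elim(1,2) by (intro integral_partial_by_parts_ACL[OF h D]) (simp_all add: mult.commute)
  then show ?case
    by (simp add: mult.commute)
qed

end

theorem theorem6:
  fixes \<mu> \<alpha> :: "real^'n" and \<Sigma> :: "real^'n^'n"
    and B :: "real measure" and p u v :: "real \<Rightarrow> real"
    and h :: "real^'n \<Rightarrow> real"
  assumes "symmetric_pos_def \<Sigma>"
    and "sigma_finite_measure B"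
    and "p \<in> borel_measurable B" "\<And>w. w \<in> space B \<Longrightarrow> 0 \<le> p w"
    and "prob_space (density B (\<lambda>w. ennreal (p w)))"
    and "u \<in> borel_measurable B" "v \<in> borel_measurable B"
    and "\<And>w. w \<in> space B \<Longrightarrow> 0 < v w"
    and "locally_ACL h" "continuous_on UNIV h"
    and "integrable (gvm_marginal B p u v \<mu> \<alpha> \<Sigma>) h"
    and "integrable (gvm_marginal B p u v \<mu> \<alpha> \<Sigma>) (gradient h)"
    and "integrable (gvm_joint B p u v \<mu> \<alpha> \<Sigma>) (\<lambda>(w, z). u w *\<^sub>R gradient h z)"
    and "integrable (gvm_joint B p u v \<mu> \<alpha> \<Sigma>) (\<lambda>(w, z). h z *\<^sub>R score_mu p u v \<mu> \<alpha> \<Sigma> w z)"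
    and "integrable (gvm_joint B p u v \<mu> \<alpha> \<Sigma>) (\<lambda>(w, z). h z *\<^sub>R score_alpha p u v \<mu> \<alpha> \<Sigma> w z)"
    and "has_gradient (\<lambda>m. \<integral>z. h z \<partial>gvm_marginal B p u v m \<alpha> \<Sigma>)
           (\<integral>(w, z). h z *\<^sub>R score_mu p u v \<mu> \<alpha> \<Sigma> w z \<partial>gvm_joint B p u v \<mu> \<alpha> \<Sigma>) \<mu>"
    and "has_gradient (\<lambda>a. \<integral>z. h z \<partial>gvm_marginal B p u v \<mu> a \<Sigma>)
           (\<integral>(w, z). h z *\<^sub>R score_alpha p u v \<mu> \<alpha> \<Sigma> w z \<partial>gvm_joint B p u v \<mu> \<alpha> \<Sigma>) \<alpha>"
  shows "has_gradient (\<lambda>m. \<integral>z. h z \<partial>gvm_marginal B p u v m \<alpha> \<Sigma>)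
           (\<integral>z. gradient h z \<partial>gvm_marginal B p u v \<mu> \<alpha> \<Sigma>) \<mu>
       \<and> has_gradient (\<lambda>a. \<integral>z. h z \<partial>gvm_marginal B p u v \<mu> a \<Sigma>)
           (\<integral>(w, z). u w *\<^sub>R gradient h z \<partial>gvm_joint B p u v \<mu> \<alpha> \<Sigma>) \<alpha>"
proof -
  note gvm = assms(1,2,3,4,6,7,8)
  let ?q = "gvm_joint_density p u v \<mu> \<alpha> \<Sigma>" and ?J = "gvm_joint B p u v \<mu> \<alpha> \<Sigma>"
  have stein: "AE w in B. (\<integral>z. ?q w z * gradient h z $ i \<partial>lborel) =
      (\<integral>z. h z * ((matrix_inv (v w *\<^sub>R \<Sigma>) *v (z - (\<mu> + u w *\<^sub>R \<alpha>))) $ i * ?q w z) \<partial>lborel)" for i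
    by (rule AE_conditional_stein[OF gvm assms(9-12,14)])
  have mu: "?q w z * (h z *\<^sub>R score_mu p u v \<mu> \<alpha> \<Sigma> w z) $ i =
      h z * ((matrix_inv (v w *\<^sub>R \<Sigma>) *v (z - (\<mu> + u w *\<^sub>R \<alpha>))) $ i * ?q w z)"
    if "w \<in> space B" for w z i
    using joint_density_score_mu[OF gvm that] by (simp add: mult.left_commute)
  have alpha: "?q w z * (h z *\<^sub>R score_alpha p u v \<mu> \<alpha> \<Sigma> w z) $ i =
      u w * (h z * ((matrix_inv (v w *\<^sub>R \<Sigma>) *v (z - (\<mu> + u w *\<^sub>R \<alpha>))) $ i * ?q w z))"
    if "w \<in> space B" for w z i
    using joint_density_score_alpha[OF gvm that] by (simp add: mult.left_commute)
  have "(\<integral>(w, z). gradient h z \<partial>?J) = (\<integral>(w, z). h z *\<^sub>R score_mu p u v \<mu> \<alpha> \<Sigma> w z \<partial>?J)"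
  proof (rule integral_joint_cong_AE[OF gvm integrable_marginal_joint[OF gvm assms(12)] assms(14)])
    fix i
    show "AE w in B. (\<integral>z. ?q w z * gradient h z $ i \<partial>lborel) =
        (\<integral>z. ?q w z * (h z *\<^sub>R score_mu p u v \<mu> \<alpha> \<Sigma> w z) $ i \<partial>lborel)"
      using stein[of i] AE_space by eventually_elim (simp only: mu)
  qed
  moreover have "(\<integral>(w, z). u w *\<^sub>R gradient h z \<partial>?J) = (\<integral>(w, z). h z *\<^sub>R score_alpha p u v \<mu> \<alpha> \<Sigma> w z \<partial>?J)"
  proof (rule integral_joint_cong_AE[OF gvm assms(13,15)])
    fix i
    have grad: "?q w z * (u w *\<^sub>R gradient h z) $ i = u w * (?q w z * gradient h z $ i)" for w z
      by simp
    show "AE w in B. (\<integral>z. ?q w z * (u w *\<^sub>R gradient h z) $ i \<partial>lborel) =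
        (\<integral>z. ?q w z * (h z *\<^sub>R score_alpha p u v \<mu> \<alpha> \<Sigma> w z) $ i \<partial>lborel)"
      \<comment> \<open>For fixed \<open>w\<close> the factor \<open>u w\<close> is a constant and
        leaves the inner integral, so the identity used for \<mu> also settles \<alpha> without a
        second integration by parts.\<close>
      using stein[of i] AE_space
      by eventually_elim (simp only: grad alpha integral_mult_right_zero)
  qed
  \<comment> \<open>The interchange hypotheses already provide both gradients as score expectations;
    only these values are replaced.\<close>
  ultimately show ?thesis
    using assms(16,17) integral_marginal_joint[OF gvm assms(12)] by simp
qed

end
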